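(* For any positive integers $m,n$, the sparse duality mapping $\mathrm J_{S_1,\mathrm{rank}}:\mathbb R^{m\times n}\to\mathbb R^{m\times n}$ is a Borel-measurable matrix-valued function over the space of $m\times n$ real matrices.
   Context: For $\mathbf A\in\mathbb R^{m\times n}$ with positive singular values $\sigma_1\ge\cdots\ge\sigma_r>0$, $\|\mathbf A\|_{S_1}=\sum_{i=1}^r\sigma_i$ and $\|\mathbf A\|_{S_\infty}=\sigma_1$. Let $\mathcal J_{S_1}(\mathbf A)$ be the set of all $\mathbf B\in\mathbb R^{m\times n}$ with $\mathrm{Tr}(\mathbf A^T\mathbf B)=\|\mathbf A\|_{S_1}\|\mathbf B\|_{S_\infty}$ and $\|\mathbf B\|_{S_\infty}=\|\mathbf A\|_{S_1}$, and let $\mathcal J_{S_1,\mathrm{rank}}(\mathbf A)$ be the set of those $\mathbf B\in\mathcal J_{S_1}(\mathbf A)$ of minimal rank among all elements of $\mathcal J_{S_1}(\mathbf A)$. This set is a singleton for every $\mathbf A$, and the sparse duality mapping $\mathrm J_{S_1,\mathrm{rank}}(\mathbf A)$ denotes its unique element. Explicitly, if a nonzero $\mathbf A$ has reduced SVD $\mathbf A=\mathbf U_r\,\mathrm{diag}(\boldsymbol\sigma)\,\mathbf V_r^T$ (with $r=\mathrm{rank}(\mathbf A)$, $\mathbf U_r^T\mathbf U_r=\mathbf V_r^T\mathbf V_r=\mathbf I_r$, and $\boldsymbol\sigma$ the vector of positive singular values), then $\mathrm J_{S_1,\mathrm{rank}}(\mathbf A)=\|\boldsymbol\sigma\|_1\mathbf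 U_r\mathbf V_r^T$. *)

theory Defs
  imports "HOL-Analysis.Analysis" "HOL-Library.Multiset"
begin

text \<open>
  An \<open>m \<times> n\<close> real matrix is an element of \<^typ>\<open>real ^ 'n ^ 'm\<close>, with \<open>m = CARD('m)\<close> and
  \<open>n = CARD('n)\<close>. The singular values are the square roots of the eigenvalues of \<open>A\<^sup>T A\<close>.
\<close>

definition singular_space :: "real ^ 'n ^ 'm \<Rightarrow> real \<Rightarrow> (real ^ 'n) set" where
  "singular_space A s = {v. (transpose A ** A) *v v = s\<^sup>2 *\<^sub>R v}"

definition positive_singular_values :: "real ^ 'n ^ 'm \<Rightarrow> real set" where
  "positive_singular_values A = {s. 0 < s \<and> (\<exists>v. v \<noteq> 0 \<and> v \<in> singular_space A s)}"

text \<open>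
  The multiset \<open>{\<sigma>\<^sub>1, \<dots>, \<sigma>\<^sub>r}\<close>. Since \<open>A\<^sup>T A\<close> is symmetric, the algebraic multiplicity of an
  eigenvalue equals the dimension of its eigenspace. The sum ranges over a finite set by
  \<open>finite_positive_singular_values\<close> below.
\<close>

definition singular_values :: "real ^ 'n ^ 'm \<Rightarrow> real multiset" where
  "singular_values A =
     (\<Sum>s\<in>positive_singular_values A. replicate_mset (dim (singular_space A s)) s)"

definition schatten_1 :: "real ^ 'n ^ 'm \<Rightarrow> real" where
  "schatten_1 A = sum_mset (singular_values A)"

text \<open>The zero matrix has no positive singular values; its norm is \<open>0\<close>.\<close>

definition schatten_inf :: "real ^ 'n ^ 'm \<Rightarrow> real" where
  "schatten_inf A = (if singular_values A = {#} then 0 else Max_mset (singular_values A))"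

definition duality_set :: "real ^ 'n ^ 'm \<Rightarrow> (real ^ 'n ^ 'm) set" where
  "duality_set A =
     {B. trace (transpose A ** B) = schatten_1 A * schatten_inf B \<and>
         schatten_inf B = schatten_1 A}"

definition sparse_duality_set :: "real ^ 'n ^ 'm \<Rightarrow> (real ^ 'n ^ 'm) set" where
  "sparse_duality_set A = {B \<in> duality_set A. \<forall>C \<in> duality_set A. rank B \<le> rank C}"

definition sparse_duality_map :: "real ^ 'n ^ 'm \<Rightarrow> real ^ 'n ^ 'm" where
  "sparse_duality_map A = (THE B. B \<in> sparse_duality_set A)"

lemma gram_inner: "((transpose A ** A) *v x) \<bullet> y = (A *v x) \<bullet> (A *v y)"
  for A :: "real ^ 'n ^ 'm"
proof -
  have "((transpose A ** A) *v x) \<bullet> y = ((A *v x) v* A) \<bullet> y"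
    by (simp add: matrix_vector_mul_assoc[symmetric])
  then show ?thesis
    by (simp add: dot_lmul_matrix)
qed

lemma singular_space_orthogonal:
  assumes "v \<in> singular_space A s" "w \<in> singular_space A t" "0 < s" "0 < t" "s \<noteq> t"
  shows "v \<bullet> w = 0"
proof -
  have "s\<^sup>2 * (v \<bullet> w) = ((transpose A ** A) *v v) \<bullet> w"
    using assms(1) by (simp add: singular_space_def)
  also have "\<dots> = ((transpose A ** A) *v w) \<bullet> v"
    by (simp only: gram_inner inner_commute[of "A *v v"])
  also have "\<dots> = t\<^sup>2 * (v \<bullet> w)"
    using assms(2) by (simp add: singular_space_def inner_commute)
  finally have "(s\<^sup>2 - t\<^sup>2) * (v \<bullet> w) = 0"
    by (simp add: algebra_simps)
  moreover have "s\<^sup>2 \<noteq> t\<^sup>2"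
    using assms(3-5) by simp
  ultimately show ?thesis by simp
qed

lemma finite_positive_singular_values: "finite (positive_singular_values A)"
proof -
  let ?S = "positive_singular_values A"
  have "\<forall>s\<in>?S. \<exists>v. v \<noteq> 0 \<and> v \<in> singular_space A s"
    by (auto simp: positive_singular_values_def)
  then obtain f where f: "\<And>s. s \<in> ?S \<Longrightarrow> f s \<noteq> 0 \<and> f s \<in> singular_space A s"
    by metis
  have orth: "f s \<bullet> f t = 0" if "s \<in> ?S" "t \<in> ?S" "s \<noteq> t" for s t
    using that f singular_space_orthogonal[of "f s" A s "f t" t]
    by (auto simp: positive_singular_values_def)
  have "inj_on f ?S"
    using orth f by (metis inj_onI inner_eq_zero_iff)
  moreover have "independent (f ` ?S)"
  proof (rule pairwise_orthogonal_independent)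
    show "pairwise orthogonal (f ` ?S)"
      using orth by (auto simp: pairwise_def orthogonal_def)
    show "0 \<notin> f ` ?S"
      using f by force
  qed
  then have "finite (f ` ?S)"
    by (rule independent_imp_finite)
  ultimately show ?thesis
    using finite_imageD by blast
qed

end

theory Submission
  imports Defs
begin

text \<open>
  Take an orthonormal eigenbasis \<open>V\<close> of \<open>A\<^sup>T A\<close>, and let \<open>P\<close> be the partial isometry sending each
  \<open>v \<in> V\<close> to \<open>A v / \<parallel>A v\<parallel>\<close> (to \<open>0\<close> if \<open>A v = 0\<close>). Expanding \<open>Tr (A\<^sup>T B)\<close> in \<open>V\<close>, the equality case
  of Cauchy-Schwarz shows that the elements of the duality set agree with \<open>\<parallel>A\<parallel>\<^sub>1 P\<close> off the kernel of
  \<open>A\<close>, and minimality of the rank forces them to vanish on the kernel. On the other hand, if the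
  polynomials \<open>p\<^sub>k\<close> converge to \<open>1 / sqrt t\<close> for every \<open>t > 0\<close>, then \<open>A p\<^sub>k(A\<^sup>T A)\<close> converges to \<open>P\<close>.
  Since \<open>\<parallel>A\<parallel>\<^sub>1 = Tr (A\<^sup>T P)\<close>, the sparse duality map is a pointwise limit of continuous functions of
  \<open>A\<close>.
\<close>

subsection \<open>Orthonormal bases\<close>

definition orthonormal_basis :: "'a::euclidean_space set \<Rightarrow> bool" where
  "orthonormal_basis V \<longleftrightarrow> pairwise orthogonal V \<and> (\<forall>v\<in>V. norm v = 1) \<and> span V = UNIV"

lemma orthonormal_basis_independent: "orthonormal_basis V \<Longrightarrow> independent V"
  by (rule pairwise_orthogonal_independent) (auto simp: orthonormal_basis_def)

lemma orthonormal_basis_finite: "orthonormal_basis V \<Longrightarrow> finite V"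
  using orthonormal_basis_independent independent_imp_finite by blast

lemma orthonormal_basis_inner:
  assumes "orthonormal_basis V" "v \<in> V" "w \<in> V"
  shows "v \<bullet> w = (if v = w then 1 else 0)"
  using assms by (auto simp: orthonormal_basis_def pairwise_def orthogonal_def norm_eq_1)

lemma orthonormal_basis_sum:
  assumes "orthonormal_basis V"
  shows "(\<Sum>v\<in>V. (x \<bullet> v) *\<^sub>R v) = x"
  using assms orthonormal_basis_finite[OF assms]
  by (intro orthonormal_basis_expand) (auto simp: orthonormal_basis_def)

lemma orthonormal_basis_inner_sum:
  assumes "orthonormal_basis V"
  shows "x \<bullet> y = (\<Sum>v\<in>V. (x \<bullet> v) * (y \<bullet> v))"
proof -
  have "x \<bullet> y = x \<bullet> (\<Sum>v\<in>V. (y \<bullet> v) *\<^sub>R v)"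
    by (simp add: orthonormal_basis_sum[OF assms])
  then show ?thesis by (simp add: inner_sum_right mult.commute)
qed

lemma orthonormal_basis_mult_sum:
  fixes A :: "real ^ 'n ^ 'm"
  assumes "orthonormal_basis V"
  shows "A *v x = (\<Sum>v\<in>V. (x \<bullet> v) *\<^sub>R (A *v v))"
proof -
  have "A *v x = A *v (\<Sum>v\<in>V. (x \<bullet> v) *\<^sub>R v)"
    by (simp add: orthonormal_basis_sum[OF assms])
  then show ?thesis
    by (simp add: linear_sum[OF matrix_vector_mul_linear] matrix_vector_mult_scaleR)
qed

lemma orthonormal_basis_matrix_eqI:
  fixes A B :: "real ^ 'n ^ 'm"
  assumes "orthonormal_basis V" "\<And>v. v \<in> V \<Longrightarrow> A *v v = B *v v"
  shows "A = B"
proof -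
  have "A *v x = B *v x" for x
    unfolding orthonormal_basis_mult_sum[OF assms(1), of A x]
      orthonormal_basis_mult_sum[OF assms(1), of B x]
    using assms(2) by simp
  then show ?thesis by (simp add: matrix_eq)
qed

text \<open>The trace is the Frobenius inner product, a sum of inner products of corresponding rows.
  Parseval in \<open>V\<close> applies to each row, and \<open>A $ k \<bullet> v\<close> is the
  coordinate \<open>k\<close> of \<open>A *v v\<close>.\<close>

lemma trace_transpose_mult_orthonormal_basis:
  fixes A B :: "real ^ 'n ^ 'm"
  assumes "orthonormal_basis V"
  shows "trace (transpose A ** B) = (\<Sum>v\<in>V. (A *v v) \<bullet> (B *v v))"
proof -
  have "trace (transpose A ** B) = (\<Sum>i\<in>UNIV. \<Sum>k\<in>UNIV. A $ k $ i * B $ k $ i)"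
    by (simp add: trace_def matrix_matrix_mult_def transpose_def)
  also have "\<dots> = (\<Sum>k\<in>UNIV. A $ k \<bullet> B $ k)"
    by (subst sum.swap) (simp add: inner_vec_def)
  also have "\<dots> = (\<Sum>k\<in>UNIV. \<Sum>v\<in>V. (A $ k \<bullet> v) * (B $ k \<bullet> v))"
    by (intro sum.cong refl orthonormal_basis_inner_sum[OF assms])
  also have "\<dots> = (\<Sum>v\<in>V. (A *v v) \<bullet> (B *v v))"
    by (subst sum.swap) (simp add: inner_vec_def matrix_vector_mult_def)
  finally show ?thesis .
qed

text \<open>First-order optimality of \<open>x\<close> for \<open>z \<mapsto> N\<^sup>2 \<parallel>z\<parallel>\<^sup>2 - \<parallel>f z\<parallel>\<^sup>2\<close>.\<close>

lemma norm_attained_imp_inner: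
  fixes f :: "'a::real_inner \<Rightarrow> 'b::real_inner"
  assumes "linear f" "subspace S"
    and bound: "\<And>z. z \<in> S \<Longrightarrow> norm (f z) \<le> N * norm z"
    and x: "x \<in> S" "norm (f x) = N * norm x" and y: "y \<in> S"
  shows "f x \<bullet> f y = N\<^sup>2 * (x \<bullet> y)"
proof (rule ccontr)
  assume neq: "f x \<bullet> f y \<noteq> N\<^sup>2 * (x \<bullet> y)"
  define c where "c = N\<^sup>2 * (x \<bullet> y) - f x \<bullet> f y"
  define d where "d = N\<^sup>2 * (norm y)\<^sup>2 - (norm (f y))\<^sup>2"
  have sq: "(norm (f z))\<^sup>2 \<le> N\<^sup>2 * (norm z)\<^sup>2" if "z \<in> S" for z
    using power_mono[OF bound[OF that], of 2] by (simp add: power_mult_distrib)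
  have d: "0 \<le> d" using sq[OF y] by (simp add: d_def)
  \<comment> \<open>This is the functional at \<open>x + t *\<^sub>R y\<close>; its constant term
    vanishes because \<open>x\<close> attains the bound.\<close>
  have nonneg: "0 \<le> 2 * t * c + t\<^sup>2 * d" for t
  proof -
    have "x + t *\<^sub>R y \<in> S"
      using assms by (simp add: subspace_add subspace_scale)
    from sq[OF this]
    have "(norm (f x + t *\<^sub>R f y))\<^sup>2 \<le> N\<^sup>2 * (norm (x + t *\<^sub>R y))\<^sup>2"
      using \<open>linear f\<close> by (simp add: linear_add linear_cmul)
    moreover have "(norm (f x))\<^sup>2 = N\<^sup>2 * (norm x)\<^sup>2"
      using x(2) by (simp add: power_mult_distrib)
    ultimately show ?thesis
      unfolding c_def d_def power2_norm_eq_inner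
      by (simp add: inner_add_left inner_add_right inner_commute algebra_simps power2_eq_square
          del: power2_norm_eq_inner)
  qed
  \<comment> \<open>A nonzero linear coefficient makes the quadratic negative at some small
    \<open>t\<close> of sign opposite to \<open>c\<close>; \<open>t = - r\<close> is such a point.
    Dividing by \<open>d + 1\<close> covers the case \<open>d = 0\<close>.\<close>
  define r where "r = c / (d + 1)"
  have c: "c = r * (d + 1)" using d by (simp add: r_def)
  then have "r \<noteq> 0" using neq by (auto simp: c_def)
  then have "0 < r\<^sup>2 * (d + 2)" using d by simp
  moreover have "2 * (- r) * c + (- r)\<^sup>2 * d = - (r\<^sup>2 * (d + 2))"
    unfolding c by (simp add: algebra_simps power2_eq_square)
  ultimately show False
    using nonneg[of "- r"] by linarith
qed

subsection \<open>Singular value decomposition\<close>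

text \<open>The singular value belonging to \<open>v\<close> is \<open>norm (A *v v)\<close>, with the zero singular values included.\<close>

definition right_singular_basis :: "real ^ 'n ^ 'm \<Rightarrow> (real ^ 'n) set \<Rightarrow> bool" where
  "right_singular_basis A V \<longleftrightarrow> orthonormal_basis V \<and>
     (\<forall>v\<in>V. (transpose A ** A) *v v = (norm (A *v v))\<^sup>2 *\<^sub>R v)"

text \<open>The unit sphere of \<open>S\<close> is compact, so the stretch has a maximiser there;
  homogeneity extends the bound to all of \<open>S\<close>.\<close>

lemma exists_max_stretch:
  fixes A :: "real ^ 'n ^ 'm"
  assumes "subspace S" "S \<noteq> {0}"
  obtains x where "x \<in> S" "norm x = 1" "\<And>z. z \<in> S \<Longrightarrow> norm (A *v z) \<le> norm (A *v x) * norm z"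
proof -
  let ?C = "S \<inter> sphere 0 1"
  have "compact ?C"
    using closed_subspace[OF assms(1)] by (simp add: closed_Int_compact)
  moreover obtain s where s: "s \<in> S" "s \<noteq> 0"
    using assms subspace_0 by blast
  then have "sgn s \<in> ?C"
    using assms(1) by (simp add: sgn_div_norm subspace_scale)
  then have "?C \<noteq> {}" by blast
  moreover have "continuous_on ?C (\<lambda>x. norm (A *v x))"
    by (intro continuous_intros)
  ultimately obtain x where x: "x \<in> ?C" "\<And>z. z \<in> ?C \<Longrightarrow> norm (A *v z) \<le> norm (A *v x)"
    using continuous_attains_sup[of ?C "\<lambda>x. norm (A *v x)"] by meson
  have "norm (A *v z) \<le> norm (A *v x) * norm z" if "z \<in> S" for z
  proof (cases "z = 0")
    case False
    then have "sgn z \<in> ?C"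
      using that assms(1) by (simp add: sgn_div_norm subspace_scale)
    then have "norm (A *v sgn z) \<le> norm (A *v x)" by (rule x)
    then show ?thesis using False
      by (simp add: sgn_div_norm matrix_vector_mult_scaleR field_simps)
  qed simp
  with x that show ?thesis by auto
qed

text \<open>The spectral theorem for \<open>A\<^sup>T A\<close> on an invariant subspace, by
  induction on its dimension: a unit vector of maximal stretch is an eigenvector, and its orthogonal
  complement in \<open>S\<close> is again invariant.\<close>

lemma exists_right_singular_vectors:
  fixes A :: "real ^ 'n ^ 'm"
  assumes "subspace S" "\<And>x. x \<in> S \<Longrightarrow> (transpose A ** A) *v x \<in> S"
  shows "\<exists>V. pairwise orthogonal V \<and> (\<forall>v\<in>V. norm v = 1) \<and> span V = S \<and>
     (\<forall>v\<in>V. (transpose A ** A) *v v = (norm (A *v v))\<^sup>2 *\<^sub>R v)"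
  using assms
proof (induction "dim S" arbitrary: S rule: less_induct)
  case less
  show ?case
  proof (cases "S = {0}")
    case True
    then show ?thesis by (intro exI[of _ "{}"]) simp
  next
    case False
    obtain x where x: "x \<in> S" "norm x = 1"
      and max: "\<And>z. z \<in> S \<Longrightarrow> norm (A *v z) \<le> norm (A *v x) * norm z"
      using exists_max_stretch[OF less.prems(1) False] by metis
    define N where "N = norm (A *v x)"
    have crit: "(A *v x) \<bullet> (A *v y) = N\<^sup>2 * (x \<bullet> y)" if "y \<in> S" for y
      unfolding N_def using max x that
      by (intro norm_attained_imp_inner[OF matrix_vector_mul_linear less.prems(1)]) simp_all
    \<comment> \<open>By \<open>crit\<close> the residual \<open>e\<close> is orthogonal to all of
      \<open>S\<close>; by invariance it lies in \<open>S\<close>, so it is zero.\<close>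
    define e where "e = (transpose A ** A) *v x - N\<^sup>2 *\<^sub>R x"
    have "e \<in> S"
      using less.prems x by (simp add: e_def subspace_diff subspace_scale)
    then have "e \<bullet> e = 0"
      using crit by (subst e_def) (simp add: inner_diff_left gram_inner)
    then have eig: "(transpose A ** A) *v x = N\<^sup>2 *\<^sub>R x"
      by (simp add: e_def)
    define T where "T = {y \<in> S. x \<bullet> y = 0}"
    have T: "subspace T"
      using less.prems(1) unfolding T_def subspace_def by (auto simp: inner_add_right)
    have invT: "(transpose A ** A) *v y \<in> T" if "y \<in> T" for y
    proof -
      have "x \<bullet> ((transpose A ** A) *v y) = (A *v x) \<bullet> (A *v y)"
        using gram_inner[of A y x] by (metis inner_commute)
      then show ?thesis using that crit less.prems(2) by (simp add: T_def)
    qed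
    have "x \<notin> T" using x by (auto simp: T_def)
    moreover have "T \<subseteq> S" by (auto simp: T_def)
    ultimately have "T \<subset> S" using x by blast
    then have "dim T < dim S"
      using T less.prems(1) by (metis dim_psubset span_eq_iff)
    from less.hyps[OF this T invT] obtain V where
      V: "pairwise orthogonal V" "\<forall>v\<in>V. norm v = 1" "span V = T"
        "\<forall>v\<in>V. (transpose A ** A) *v v = (norm (A *v v))\<^sup>2 *\<^sub>R v" by blast
    have VT: "V \<subseteq> T" using V(3) span_superset by blast
    have "span (insert x V) = S"
    proof
      show "span (insert x V) \<subseteq> S"
        using VT x less.prems(1) by (intro span_minimal) (auto simp: T_def)
      show "S \<subseteq> span (insert x V)"
      proof
        fix y assume y: "y \<in> S"
        have "y - (x \<bullet> y) *\<^sub>R x \<in> T"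
          using y x less.prems(1)
          by (simp add: T_def subspace_diff subspace_scale inner_diff_right norm_eq_1)
        then show "y \<in> span (insert x V)"
          using V(3) by (auto simp: span_insert)
      qed
    qed
    moreover have "pairwise orthogonal (insert x V)"
      using V(1) VT by (auto simp: pairwise_insert T_def orthogonal_def inner_commute)
    ultimately show ?thesis
      using V x eig by (intro exI[of _ "insert x V"]) (auto simp: N_def)
  qed
qed

lemma exists_right_singular_basis: "\<exists>V. right_singular_basis A V"
  using exists_right_singular_vectors[of UNIV A]
  by (auto simp: right_singular_basis_def orthonormal_basis_def)

lemma right_singular_basisD:
  assumes "right_singular_basis A V"
  shows "orthonormal_basis V"
    and "v \<in> V \<Longrightarrow> (transpose A ** A) *v v = (norm (A *v v))\<^sup>2 *\<^sub>R v"
  using assms by (auto simp: right_singular_basis_def)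

lemma right_singular_basis_image_orthogonal:
  assumes "right_singular_basis A V" "v \<in> V" "w \<in> V" "v \<noteq> w"
  shows "(A *v v) \<bullet> (A *v w) = 0"
proof -
  have "(A *v v) \<bullet> (A *v w) = ((transpose A ** A) *v v) \<bullet> w"
    by (simp only: gram_inner)
  also have "\<dots> = 0"
    using assms orthonormal_basis_inner[OF right_singular_basisD(1)[OF assms(1)], of v w]
    by (simp add: right_singular_basisD(2)[OF assms(1)])
  finally show ?thesis .
qed

section \<open>Singular values and Schatten norms in terms of a right singular basis\<close>

text \<open>By symmetry of \<open>A\<^sup>T A\<close>, an eigenvector has no component along basis
  vectors with a different eigenvalue. For nonnegative \<open>s\<close>, different singular values
  have different squares.\<close>

lemma singular_space_eq_span:
  assumes "right_singular_basis A V" "0 \<le> s"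
  shows "singular_space A s = span {v \<in> V. norm (A *v v) = s}"
proof
  note V = right_singular_basisD[OF assms(1)]
  show "singular_space A s \<subseteq> span {v \<in> V. norm (A *v v) = s}"
  proof
    fix w assume w: "w \<in> singular_space A s"
    have zero: "w \<bullet> v = 0" if v: "v \<in> V" "norm (A *v v) \<noteq> s" for v
    proof -
      have "s\<^sup>2 * (w \<bullet> v) = ((transpose A ** A) *v w) \<bullet> v"
        using w by (simp add: singular_space_def)
      also have "\<dots> = ((transpose A ** A) *v v) \<bullet> w"
        by (simp only: gram_inner inner_commute[of "A *v w"])
      also have "\<dots> = (norm (A *v v))\<^sup>2 * (w \<bullet> v)"
        using V(2)[OF v(1)] by (simp add: inner_commute)
      finally have "(s\<^sup>2 - (norm (A *v v))\<^sup>2) * (w \<bullet> v) = 0"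
        by (simp add: algebra_simps)
      moreover have "s\<^sup>2 \<noteq> (norm (A *v v))\<^sup>2"
        using v(2) assms(2) by (metis norm_ge_zero power2_eq_imp_eq)
      ultimately show ?thesis by simp
    qed
    have "w = (\<Sum>v\<in>V. (w \<bullet> v) *\<^sub>R v)"
      by (simp add: orthonormal_basis_sum[OF V(1)])
    also have "\<dots> = (\<Sum>v\<in>{v \<in> V. norm (A *v v) = s}. (w \<bullet> v) *\<^sub>R v)"
      using zero orthonormal_basis_finite[OF V(1)] by (intro sum.mono_neutral_right) auto
    also have "\<dots> \<in> span {v \<in> V. norm (A *v v) = s}"
      by (intro span_sum span_scale span_base)
    finally show "w \<in> span {v \<in> V. norm (A *v v) = s}" .
  qed
  have "subspace (singular_space A s)"
    by (simp add: singular_space_def subspace_def matrix_vector_right_distrib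
        scaleR_right_distrib matrix_vector_mult_scaleR)
  then show "span {v \<in> V. norm (A *v v) = s} \<subseteq> singular_space A s"
    by (intro span_minimal) (auto simp: singular_space_def V(2))
qed

lemma dim_singular_space:
  assumes "right_singular_basis A V" "0 \<le> s"
  shows "dim (singular_space A s) = card {v \<in> V. norm (A *v v) = s}"
proof -
  have "independent {v \<in> V. norm (A *v v) = s}"
    using orthonormal_basis_independent[OF right_singular_basisD(1)[OF assms(1)]]
    by (rule independent_mono) auto
  then show ?thesis
    by (simp add: singular_space_eq_span[OF assms] dim_eq_card_independent)
qed

lemma positive_singular_values_eq:
  assumes "right_singular_basis A V"
  shows "positive_singular_values A = (\<lambda>v. norm (A *v v)) ` {v \<in> V. A *v v \<noteq> 0}"
proof -
  have "(\<exists>v. v \<noteq> 0 \<and> v \<in> singular_space A s) \<longleftrightarrow> (\<exists>v\<in>V. norm (A *v v) = s)" if "0 < s" for s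
  proof -
    have "(\<exists>v. v \<noteq> 0 \<and> v \<in> singular_space A s) \<longleftrightarrow> \<not> singular_space A s \<subseteq> {0}"
      by blast
    also have "\<dots> \<longleftrightarrow> dim (singular_space A s) \<noteq> 0"
      by (simp add: dim_eq_0)
    also have "\<dots> \<longleftrightarrow> {v \<in> V. norm (A *v v) = s} \<noteq> {}"
      using that orthonormal_basis_finite[OF right_singular_basisD(1)[OF assms]]
      by (subst dim_singular_space[OF assms]) auto
    finally show ?thesis by blast
  qed
  then have "s \<in> positive_singular_values A \<longleftrightarrow> 0 < s \<and> (\<exists>v\<in>V. norm (A *v v) = s)" for s
    unfolding positive_singular_values_def by blast
  then show ?thesis
    by (intro set_eqI) (simp add: image_iff, metis norm_eq_zero norm_ge_zero order_le_less zero_less_norm_iff)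
qed

text \<open>The multiplicity of a positive \<open>t\<close> is the dimension of an eigenspace on the
  left and the size of a fibre of the norm on the right; \<open>dim_singular_space\<close>
  identifies the two.\<close>

lemma singular_values_eq:
  assumes "right_singular_basis A V"
  shows "singular_values A = image_mset (\<lambda>v. norm (A *v v)) (mset_set {v \<in> V. A *v v \<noteq> 0})"
proof (rule multiset_eqI)
  fix t
  let ?W = "{v \<in> V. A *v v \<noteq> 0}" and ?S = "positive_singular_values A"
  have fin: "finite V"
    using orthonormal_basis_finite[OF right_singular_basisD(1)[OF assms]] .
  have S: "?S = (\<lambda>v. norm (A *v v)) ` ?W"
    by (rule positive_singular_values_eq[OF assms])
  have "count (singular_values A) t =
      (\<Sum>s\<in>?S. count (replicate_mset (dim (singular_space A s)) s) t)"
    by (simp add: singular_values_def count_sum)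
  \<comment> \<open>Each summand contains copies of its own index only, so just \<open>s = t\<close>
    contributes.\<close>
  also have "\<dots> = (if t \<in> ?S then dim (singular_space A t) else 0)"
    using finite_positive_singular_values[of A] by (simp add: sum.delta)
  also have "\<dots> = card {v \<in> ?W. norm (A *v v) = t}"
  proof (cases "t \<in> ?S")
    case True
    then have "0 < t" by (simp add: positive_singular_values_def)
    then have "{v \<in> ?W. norm (A *v v) = t} = {v \<in> V. norm (A *v v) = t}" by auto
    then show ?thesis
      using True \<open>0 < t\<close> by (simp add: dim_singular_space[OF assms])
  next
    case False
    then have "{v \<in> ?W. norm (A *v v) = t} = {}" by (auto simp: S)
    then show ?thesis using False by (metis card.empty)
  qed
  also have "\<dots> = count (image_mset (\<lambda>v. norm (A *v v)) (mset_set ?W)) t"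
    using fin by (simp add: count_image_mset Int_def vimage_def conj_commute)
  finally show "count (singular_values A) t =
      count (image_mset (\<lambda>v. norm (A *v v)) (mset_set ?W)) t" .
qed

lemma schatten_1_eq:
  assumes "right_singular_basis A V"
  shows "schatten_1 A = (\<Sum>v\<in>V. norm (A *v v))"
proof -
  have "schatten_1 A = (\<Sum>v\<in>{v \<in> V. A *v v \<noteq> 0}. norm (A *v v))"
    by (simp add: schatten_1_def singular_values_eq[OF assms] sum_unfold_sum_mset)
  also have "\<dots> = (\<Sum>v\<in>V. norm (A *v v))"
    using orthonormal_basis_finite[OF right_singular_basisD(1)[OF assms]]
    by (intro sum.mono_neutral_left) auto
  finally show ?thesis .
qed

text \<open>In a singular basis, the squared length of \<open>A *v x\<close> is a sum of squared
  singular values weighted by squared coordinates of \<open>x\<close>, and the largest singular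
  value is attained at a basis vector. The result is basis-free, so \<open>B\<close> can be bounded
  on a singular basis of \<open>A\<close>.\<close>

lemma schatten_inf_eq_onorm: "schatten_inf A = onorm ((*v) A)"
proof -
  obtain V where RS: "right_singular_basis A V"
    using exists_right_singular_basis by blast
  note V = right_singular_basisD[OF RS]
  let ?W = "{v \<in> V. A *v v \<noteq> 0}"
  have fin: "finite V" using orthonormal_basis_finite[OF V(1)] .
  have inf: "schatten_inf A = (if ?W = {} then 0 else Max ((\<lambda>v. norm (A *v v)) ` ?W))"
    unfolding schatten_inf_def singular_values_eq[OF RS] using fin
    by (auto simp: mset_set_empty_iff)
  have nonneg: "0 \<le> schatten_inf A"
  proof (cases "?W = {}")
    case False
    then obtain v where "v \<in> ?W" by blast
    then have "norm (A *v v) \<le> schatten_inf A"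
      unfolding inf using fin by auto
    then show ?thesis using norm_ge_zero order_trans by blast
  qed (simp add: inf)
  have le: "norm (A *v v) \<le> schatten_inf A" if "v \<in> V" for v
  proof (cases "A *v v = 0")
    case False
    then have "v \<in> ?W" using that by simp
    then show ?thesis unfolding inf using fin by auto
  qed (simp add: nonneg)
  have "norm (A *v x) \<le> schatten_inf A * norm x" for x
  proof (rule power2_le_imp_le)
    have "(norm (A *v x))\<^sup>2 = ((transpose A ** A) *v x) \<bullet> x"
      by (simp add: gram_inner power2_norm_eq_inner)
    also have "\<dots> = (\<Sum>v\<in>V. (((transpose A ** A) *v x) \<bullet> v) * (x \<bullet> v))"
      by (rule orthonormal_basis_inner_sum[OF V(1)])
    also have "\<dots> = (\<Sum>v\<in>V. (norm (A *v v))\<^sup>2 * (x \<bullet> v)\<^sup>2)"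
    proof (rule sum.cong)
      fix v assume v: "v \<in> V"
      have "((transpose A ** A) *v x) \<bullet> v = ((transpose A ** A) *v v) \<bullet> x"
        by (simp only: gram_inner inner_commute[of "A *v x"])
      then show "(((transpose A ** A) *v x) \<bullet> v) * (x \<bullet> v) = (norm (A *v v))\<^sup>2 * (x \<bullet> v)\<^sup>2"
        using V(2)[OF v] by (simp add: inner_commute power2_eq_square)
    qed simp
    also have "\<dots> \<le> (\<Sum>v\<in>V. (schatten_inf A)\<^sup>2 * (x \<bullet> v)\<^sup>2)"
      using le by (intro sum_mono mult_right_mono power_mono) auto
    also have "\<dots> = (schatten_inf A)\<^sup>2 * (x \<bullet> x)"
      by (subst orthonormal_basis_inner_sum[OF V(1), of x x])
        (simp add: sum_distrib_left power2_eq_square)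
    finally show "(norm (A *v x))\<^sup>2 \<le> (schatten_inf A * norm x)\<^sup>2"
      by (simp add: power_mult_distrib power2_norm_eq_inner)
  qed (use nonneg in simp)
  then have "onorm ((*v) A) \<le> schatten_inf A"
    by (rule onorm_le)
  moreover have "schatten_inf A \<le> onorm ((*v) A)"
  proof (cases "?W = {}")
    case True
    then show ?thesis by (simp add: inf onorm_pos_le)
  next
    case False
    then have "schatten_inf A \<in> (\<lambda>v. norm (A *v v)) ` ?W"
      unfolding inf if_not_P[OF False] using fin by (intro Max_in) auto
    then obtain v where "v \<in> V" "schatten_inf A = norm (A *v v)" by auto
    then show ?thesis
      using onorm[OF matrix_vector_mul_bounded_linear, of A v] V(1)
      by (simp add: orthonormal_basis_def)
  qed
  ultimately show ?thesis by simp
qed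

section \<open>The polar factor: action, norm and trace\<close>

text \<open>
  This is \<open>U\<^sub>r V\<^sub>r\<^sup>T\<close>: the left singular vector belonging to \<open>v\<close> is \<open>sgn (A *v v)\<close>, and \<open>sgn 0 = 0\<close>
  discards the kernel of \<open>A\<close>.
\<close>

definition polar_factor :: "real ^ 'n ^ 'm \<Rightarrow> (real ^ 'n) set \<Rightarrow> real ^ 'n ^ 'm" where
  "polar_factor A V = matrix (\<lambda>x. \<Sum>v\<in>V. (x \<bullet> v) *\<^sub>R sgn (A *v v))"

lemma polar_factor_mult:
  "polar_factor A V *v x = (\<Sum>v\<in>V. (x \<bullet> v) *\<^sub>R sgn (A *v v))"
proof -
  have "linear (\<lambda>x. \<Sum>v\<in>V. (x \<bullet> v) *\<^sub>R sgn (A *v v))"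
    by (intro linearI) (simp_all add: inner_add_left scaleR_left_distrib sum.distrib scaleR_sum_right)
  then show ?thesis by (simp add: polar_factor_def matrix_works)
qed

lemma polar_factor_basis:
  assumes "orthonormal_basis V" "v \<in> V"
  shows "polar_factor A V *v v = sgn (A *v v)"
proof -
  have "polar_factor A V *v v = (\<Sum>w\<in>V. if v = w then sgn (A *v w) else 0)"
    unfolding polar_factor_mult
    by (intro sum.cong refl) (simp add: orthonormal_basis_inner[OF assms(1,2)])
  then show ?thesis
    using assms(2) orthonormal_basis_finite[OF assms(1)] by simp
qed

text \<open>The images \<open>sgn (A *v v)\<close> are pairwise orthogonal of length at most 1, so
  Pythagoras compares the two sides coordinate by coordinate.\<close>

lemma polar_factor_norm_le:
  assumes "right_singular_basis A V"
  shows "norm (polar_factor A V *v x) \<le> norm x"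
proof (rule power2_le_imp_le)
  note V = right_singular_basisD[OF assms]
  have fin: "finite V" using orthonormal_basis_finite[OF V(1)] .
  let ?f = "\<lambda>v. (x \<bullet> v) *\<^sub>R sgn (A *v v)"
  have "pairwise (\<lambda>v w. orthogonal (?f v) (?f w)) V"
    using right_singular_basis_image_orthogonal[OF assms]
    by (simp add: pairwise_def orthogonal_def sgn_div_norm)
  then have "(norm (polar_factor A V *v x))\<^sup>2 = (\<Sum>v\<in>V. (norm (?f v))\<^sup>2)"
    unfolding polar_factor_mult using fin by (rule norm_sum_Pythagorean[rotated])
  also have "\<dots> \<le> (\<Sum>v\<in>V. (x \<bullet> v) * (x \<bullet> v))"
    by (intro sum_mono) (simp add: norm_sgn power2_eq_square)
  also have "\<dots> = (norm x)\<^sup>2"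
    by (simp add: power2_norm_eq_inner orthonormal_basis_inner_sum[OF V(1), of x x])
  finally show "(norm (polar_factor A V *v x))\<^sup>2 \<le> (norm x)\<^sup>2" .
qed simp

lemma norm_mult_le_schatten_inf: "norm (B *v x) \<le> schatten_inf B * norm x"
  unfolding schatten_inf_eq_onorm by (rule onorm) simp

lemma schatten_inf_scaled_polar_factor:
  assumes "right_singular_basis A V"
  shows "schatten_inf (schatten_1 A *\<^sub>R polar_factor A V) = schatten_1 A"
proof -
  note V = right_singular_basisD[OF assms]
  let ?N = "schatten_1 A" and ?B = "schatten_1 A *\<^sub>R polar_factor A V"
  have N: "0 \<le> ?N" by (simp add: schatten_1_eq[OF assms] sum_nonneg)
  have B: "?B *v x = ?N *\<^sub>R (polar_factor A V *v x)" for x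
    by (simp add: scaleR_matrix_vector_assoc)
  have "onorm ((*v) ?B) \<le> ?N"
    using N polar_factor_norm_le[OF assms] by (intro onorm_le) (simp add: B mult_left_mono)
  moreover have "?N \<le> onorm ((*v) ?B)"
  proof (cases "\<exists>v\<in>V. A *v v \<noteq> 0")
    case True
    then obtain v where v: "v \<in> V" "A *v v \<noteq> 0" by blast
    then have "norm (?B *v v) = ?N"
      using N by (simp add: B polar_factor_basis[OF V(1)] norm_sgn)
    then show ?thesis
      using onorm[OF matrix_vector_mul_bounded_linear, of ?B v] V(1) v(1)
      by (simp add: orthonormal_basis_def)
  next
    \<comment> \<open>Now all summands of \<open>schatten_1_eq\<close> vanish, so the norm to be
      attained is zero.\<close>
    case False
    then show ?thesis by (simp add: schatten_1_eq[OF assms] onorm_pos_le)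
  qed
  ultimately show ?thesis by (simp add: schatten_inf_eq_onorm)
qed

text \<open>This expresses the norm continuously through the polar factor, so an approximation of
  the polar factor also approximates \<open>schatten_1 A\<close>.\<close>

lemma trace_polar_factor:
  assumes "right_singular_basis A V"
  shows "trace (transpose A ** polar_factor A V) = schatten_1 A"
proof -
  note V = right_singular_basisD[OF assms]
  have "(A *v v) \<bullet> sgn (A *v v) = norm (A *v v)" for v
    by (cases "A *v v = 0") (simp_all add: sgn_div_norm dot_square_norm power2_eq_square)
  then show ?thesis
    by (simp add: trace_transpose_mult_orthonormal_basis[OF V(1)] schatten_1_eq[OF assms]
        polar_factor_basis[OF V(1)])
qed

subsection \<open>The sparse duality map\<close>

text \<open>Once the norm of \<open>B\<close> is fixed, both the trace and \<open>?N * ?N\<close>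
  are sums over \<open>V\<close>, and the first is dominated term by term. Equal sums therefore
  force equality in Cauchy-Schwarz at every \<open>v\<close>.\<close>

lemma duality_set_iff:
  assumes "right_singular_basis A V"
  shows "B \<in> duality_set A \<longleftrightarrow> schatten_inf B = schatten_1 A \<and>
    (\<forall>v\<in>V. A *v v \<noteq> 0 \<longrightarrow> B *v v = schatten_1 A *\<^sub>R sgn (A *v v))"
proof -
  note V = right_singular_basisD[OF assms]
  have fin: "finite V" using orthonormal_basis_finite[OF V(1)] .
  let ?N = "schatten_1 A"
  have trace: "trace (transpose A ** B) = (\<Sum>v\<in>V. (A *v v) \<bullet> (B *v v))"
    by (rule trace_transpose_mult_orthonormal_basis[OF V(1)])
  have sq: "?N * ?N = (\<Sum>v\<in>V. norm (A *v v) * ?N)"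
    by (subst schatten_1_eq[OF assms]) (simp add: sum_distrib_right)
  have term_eq: "(A *v v) \<bullet> (B *v v) = norm (A *v v) * ?N \<longleftrightarrow>
      (A *v v \<noteq> 0 \<longrightarrow> B *v v = ?N *\<^sub>R sgn (A *v v))"
    if N: "norm (B *v v) \<le> ?N" for v
  proof (cases "A *v v = 0")
    case False
    let ?u = "sgn (A *v v)"
    have Av: "A *v v = norm (A *v v) *\<^sub>R ?u"
      using False by (simp add: sgn_div_norm)
    have u: "?u \<bullet> ?u = 1"
      using False by (simp add: dot_square_norm norm_sgn)
    have "(A *v v) \<bullet> (B *v v) = norm (A *v v) * (?u \<bullet> (B *v v))"
      by (subst Av) simp
    then have "(A *v v) \<bullet> (B *v v) = norm (A *v v) * ?N \<longleftrightarrow> ?u \<bullet> (B *v v) = ?N"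
      using False by simp
    also have "\<dots> \<longleftrightarrow> B *v v = ?N *\<^sub>R ?u"
    proof
      \<comment> \<open>The component of \<open>B *v v\<close> along the unit vector
        \<open>?u\<close> already has the maximal permitted length, so nothing remains orthogonal to
        it.\<close>
      assume eq: "?u \<bullet> (B *v v) = ?N"
      have "(norm (B *v v - ?N *\<^sub>R ?u))\<^sup>2 = (norm (B *v v))\<^sup>2 - ?N\<^sup>2"
        unfolding power2_norm_eq_inner
        using u eq by (simp add: inner_diff_left inner_diff_right inner_commute power2_eq_square)
      also have "\<dots> \<le> 0"
        using N by (simp add: power_mono)
      finally show "B *v v = ?N *\<^sub>R ?u" by simp
    qed (simp add: u)
    finally show ?thesis using False by simp
  qed simp
  have "trace (transpose A ** B) = ?N * ?N \<longleftrightarrow>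
      (\<forall>v\<in>V. A *v v \<noteq> 0 \<longrightarrow> B *v v = ?N *\<^sub>R sgn (A *v v))"
    if B: "schatten_inf B = ?N"
  proof -
    have BN: "norm (B *v v) \<le> ?N" if "v \<in> V" for v
      using norm_mult_le_schatten_inf[of B v] that V(1) B by (simp add: orthonormal_basis_def)
    have le: "(A *v v) \<bullet> (B *v v) \<le> norm (A *v v) * ?N" if "v \<in> V" for v
      using norm_cauchy_schwarz[of "A *v v" "B *v v"] mult_left_mono[OF BN[OF that], of "norm (A *v v)"]
      by simp
    have "trace (transpose A ** B) = ?N * ?N \<longleftrightarrow>
        (\<forall>v\<in>V. (A *v v) \<bullet> (B *v v) = norm (A *v v) * ?N)"
      unfolding trace sq using sum_mono_inv[OF _ le _ fin] by (auto intro: sum.cong)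
    then show ?thesis using term_eq[OF BN] by blast
  qed
  then show ?thesis by (auto simp: duality_set_def)
qed

lemma scaled_polar_factor_in_duality_set:
  assumes "right_singular_basis A V"
  shows "schatten_1 A *\<^sub>R polar_factor A V \<in> duality_set A"
  by (simp add: duality_set_iff[OF assms] schatten_inf_scaled_polar_factor[OF assms]
      scaleR_matrix_vector_assoc[symmetric]
      polar_factor_basis[OF right_singular_basisD(1)[OF assms]])

text \<open>Gives the scaled polar factor minimal rank in the duality set: dropping the kernel
  component of \<open>x\<close> does not change its image under the polar factor, and on the
  remaining component \<open>B\<close> is prescribed.\<close>

lemma range_scaled_polar_factor_subset:
  assumes RS: "right_singular_basis A V" and B: "B \<in> duality_set A"
  shows "range ((*v) (schatten_1 A *\<^sub>R polar_factor A V)) \<subseteq> range ((*v) B)"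
proof clarify
  fix x
  note V = right_singular_basisD[OF RS]
  \<comment> \<open>The projection of \<open>x\<close> onto the orthogonal complement of the kernel
    of \<open>A\<close>.\<close>
  let ?y = "\<Sum>v\<in>{v \<in> V. A *v v \<noteq> 0}. (x \<bullet> v) *\<^sub>R v"
  have "B *v ?y = (\<Sum>v\<in>{v \<in> V. A *v v \<noteq> 0}. (x \<bullet> v) *\<^sub>R (B *v v))"
    by (simp add: linear_sum[OF matrix_vector_mul_linear] matrix_vector_mult_scaleR)
  also have "\<dots> = (\<Sum>v\<in>{v \<in> V. A *v v \<noteq> 0}. schatten_1 A *\<^sub>R (x \<bullet> v) *\<^sub>R sgn (A *v v))"
    using B by (intro sum.cong) (auto simp: duality_set_iff[OF RS] mult.commute)
  also have "\<dots> = (\<Sum>v\<in>V. schatten_1 A *\<^sub>R (x \<bullet> v) *\<^sub>R sgn (A *v v))"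
    using orthonormal_basis_finite[OF V(1)] by (intro sum.mono_neutral_left) auto
  also have "\<dots> = (schatten_1 A *\<^sub>R polar_factor A V) *v x"
    by (simp only: scaleR_matrix_vector_assoc[symmetric] polar_factor_mult scaleR_sum_right)
  finally have "B *v ?y = (schatten_1 A *\<^sub>R polar_factor A V) *v x" .
  then show "(schatten_1 A *\<^sub>R polar_factor A V) *v x \<in> range ((*v) B)"
    by (rule range_eqI[OF sym])
qed

lemma duality_set_minimal_rank_unique:
  assumes RS: "right_singular_basis A V" and B: "B \<in> duality_set A"
    and rank: "rank B \<le> rank (schatten_1 A *\<^sub>R polar_factor A V)"
  shows "B = schatten_1 A *\<^sub>R polar_factor A V"
proof (rule orthonormal_basis_matrix_eqI)
  note V = right_singular_basisD[OF RS]
  let ?N = "schatten_1 A" and ?P = "polar_factor A V"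
  show "orthonormal_basis V" by (rule V(1))
  have Bdual: "schatten_inf B = ?N" "\<And>v. v \<in> V \<Longrightarrow> A *v v \<noteq> 0 \<Longrightarrow> B *v v = ?N *\<^sub>R sgn (A *v v)"
    using B unfolding duality_set_iff[OF RS] by blast+
  have N: "0 \<le> ?N" by (simp add: schatten_1_eq[OF RS] sum_nonneg)
  have subspace: "subspace (range ((*v) C))" for C :: "real ^ 'n ^ 'm"
    by (intro linear_subspace_image) simp_all
  \<comment> \<open>One inclusion always holds; the rank bound upgrades it to equality. This is the
    only use of minimality.\<close>
  have range: "range ((*v) (?N *\<^sub>R ?P)) = range ((*v) B)"
    using rank by (intro subspace_dim_equal subspace range_scaled_polar_factor_subset[OF RS B])
      (simp add: rank_dim_range)
  fix v assume v: "v \<in> V"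
  show "B *v v = (?N *\<^sub>R ?P) *v v"
  proof (cases "A *v v = 0")
    case True
    \<comment> \<open>\<open>B v\<close> lies in the span of the vectors \<open>B w\<close> with \<open>A w \<noteq> 0\<close>. As \<open>B\<close> attains its norm at
      each of these \<open>w\<close>, \<open>B v\<close> is orthogonal to all of them.\<close>
    obtain x where "B *v v = (?N *\<^sub>R ?P) *v x"
      using range by (metis rangeE rangeI)
    then have Bv: "B *v v = (\<Sum>w\<in>V. (x \<bullet> w) *\<^sub>R (?N *\<^sub>R sgn (A *v w)))"
      by (simp add: scaleR_matrix_vector_assoc[symmetric] polar_factor_mult scaleR_sum_right mult.commute)
    have zero: "(B *v v) \<bullet> (?N *\<^sub>R sgn (A *v w)) = 0" if w: "w \<in> V" for w
    proof (cases "A *v w = 0")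
      case False
      have "norm (B *v w) = ?N * norm w"
        using False w N V(1) by (simp add: Bdual(2) norm_sgn orthonormal_basis_def)
      then have "(B *v w) \<bullet> (B *v v) = ?N\<^sup>2 * (w \<bullet> v)"
        using norm_mult_le_schatten_inf[of B] Bdual(1)
        by (intro norm_attained_imp_inner[OF matrix_vector_mul_linear subspace_UNIV]) simp_all
      also have "\<dots> = 0"
        using True False by (auto simp: orthonormal_basis_inner[OF V(1) w v])
      finally show ?thesis using Bdual(2)[OF w False] by (simp add: inner_commute)
    qed simp
    have "(B *v v) \<bullet> (B *v v) = (\<Sum>w\<in>V. (x \<bullet> w) * ((B *v v) \<bullet> (?N *\<^sub>R sgn (A *v w))))"
      by (subst (2) Bv) (simp add: inner_sum_right mult.assoc)
    also have "\<dots> = 0"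
      using zero by (intro sum.neutral) simp
    finally show ?thesis
      using True by (simp add: scaleR_matrix_vector_assoc[symmetric] polar_factor_basis[OF V(1) v])
  next
    case False
    then show ?thesis
      using v by (simp add: Bdual(2) scaleR_matrix_vector_assoc[symmetric] polar_factor_basis[OF V(1)])
  qed
qed

text \<open>Existence and uniqueness of the minimal-rank element justify the definite description.
  In particular the right-hand side is independent of the choice of \<open>V\<close>.\<close>

lemma sparse_duality_map_eq:
  assumes "right_singular_basis A V"
  shows "sparse_duality_map A = schatten_1 A *\<^sub>R polar_factor A V"
proof -
  let ?B = "schatten_1 A *\<^sub>R polar_factor A V"
  have dual: "?B \<in> duality_set A"
    by (rule scaled_polar_factor_in_duality_set[OF assms])
  have "rank ?B \<le> rank C" if "C \<in> duality_set A" for C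
    unfolding rank_dim_range
    using range_scaled_polar_factor_subset[OF assms that] by (rule dim_subset)
  then have "?B \<in> sparse_duality_set A"
    using dual by (simp add: sparse_duality_set_def)
  moreover have "B = ?B" if "B \<in> sparse_duality_set A" for B
    using that dual duality_set_minimal_rank_unique[OF assms, of B]
    by (simp add: sparse_duality_set_def)
  ultimately show ?thesis
    unfolding sparse_duality_map_def by (rule the_equality)
qed

subsection \<open>Polynomial approximation of the polar factor\<close>

definition matrix_poly :: "(nat \<Rightarrow> real) \<Rightarrow> nat \<Rightarrow> real ^ 'n ^ 'n \<Rightarrow> real ^ 'n ^ 'n" where
  "matrix_poly a d M = (\<Sum>i\<le>d. a i *\<^sub>R (((**) M) ^^ i) (mat 1))"

lemma sum_matrix_vector_mult:
  "(\<Sum>i\<in>I. F i) *v x = (\<Sum>i\<in>I. F i *v x)" for F :: "'i \<Rightarrow> real ^ 'n ^ 'm"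
  by (induction I rule: infinite_finite_induct) (simp_all add: matrix_vector_mult_add_rdistrib)

lemma matrix_poly_eigenvector:
  assumes "M *v v = c *\<^sub>R v"
  shows "matrix_poly a d M *v v = (\<Sum>i\<le>d. a i * c ^ i) *\<^sub>R v"
proof -
  have "(((**) M) ^^ i) (mat 1) *v v = c ^ i *\<^sub>R v" for i
    by (induction i)
      (simp_all add: matrix_vector_mul_assoc[symmetric] matrix_vector_mult_scaleR assms mult.commute)
  then show ?thesis
    by (simp add: matrix_poly_def sum_matrix_vector_mult scaleR_matrix_vector_assoc[symmetric]
        scaleR_sum_left)
qed

section \<open>Continuity and limits of matrix expressions\<close>

lemma continuous_on_matrix_mult:
  fixes f :: "'a::topological_space \<Rightarrow> real ^ 'n ^ 'm" and g :: "'a \<Rightarrow> real ^ 'p ^ 'n"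
  assumes "continuous_on S f" "continuous_on S g"
  shows "continuous_on S (\<lambda>x. f x ** g x)"
  unfolding matrix_matrix_mult_def using assms by (intro continuous_intros)

lemma continuous_on_transpose:
  fixes f :: "'a::topological_space \<Rightarrow> real ^ 'n ^ 'm"
  assumes "continuous_on S f"
  shows "continuous_on S (\<lambda>x. transpose (f x))"
  unfolding transpose_def using assms by (intro continuous_intros)

lemma continuous_on_trace:
  fixes f :: "'a::topological_space \<Rightarrow> real ^ 'n ^ 'n"
  assumes "continuous_on S f"
  shows "continuous_on S (\<lambda>x. trace (f x))"
  unfolding trace_def using assms by (intro continuous_intros)

lemma continuous_on_matrix_poly:
  assumes "continuous_on S f"
  shows "continuous_on S (\<lambda>x. matrix_poly a d (f x))"
proof -
  have "continuous_on S (\<lambda>x. (((**) (f x)) ^^ i) (mat 1))" for i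
    by (induction i) (simp_all add: continuous_on_matrix_mult assms)
  then show ?thesis
    unfolding matrix_poly_def by (intro continuous_intros)
qed

text \<open>Each column is the image of a standard basis vector, hence a fixed linear combination of
  the images of \<open>V\<close>; so convergence on \<open>V\<close> gives entrywise
  convergence.\<close>

lemma tendsto_matrixI:
  fixes F :: "'a \<Rightarrow> real ^ 'n ^ 'm"
  assumes "orthonormal_basis V" "\<And>v. v \<in> V \<Longrightarrow> ((\<lambda>k. F k *v v) \<longlongrightarrow> M *v v) net"
  shows "(F \<longlongrightarrow> M) net"
proof (intro vec_tendstoI)
  fix i j
  have expand: "C *v axis j 1 = (\<Sum>v\<in>V. (axis j 1 \<bullet> v) *\<^sub>R (C *v v))" for C :: "real ^ 'n ^ 'm"
    by (rule orthonormal_basis_mult_sum[OF assms(1)])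
  have "((\<lambda>k. F k *v axis j 1) \<longlongrightarrow> M *v axis j 1) net"
    unfolding expand using assms(2) by (intro tendsto_intros)
  from tendsto_vec_nth[OF this, of i]
  show "((\<lambda>k. F k $ i $ j) \<longlongrightarrow> M $ i $ j) net"
    by (simp add: matrix_vector_mult_basis column_def)
qed

text \<open>Weierstrass approximation on the compact intervals from \<open>1 / real (Suc k)\<close>
  to \<open>real (Suc k)\<close>, with error below \<open>1 / real (Suc k)\<close>. These intervals
  exhaust the positive axis, so each fixed \<open>t\<close> is eventually covered.\<close>

lemma exists_poly_approx_inverse_sqrt:
  obtains a :: "nat \<Rightarrow> nat \<Rightarrow> real" and d where
    "\<And>t. 0 < t \<Longrightarrow> (\<lambda>k. \<Sum>i\<le>d k. a k i * t ^ i) \<longlonglongrightarrow> 1 / sqrt t"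
proof -
  have "\<exists>a d. \<forall>t\<in>{1 / real (Suc k)..real (Suc k)}.
      \<bar>1 / sqrt t - (\<Sum>i\<le>d. a i * t ^ i)\<bar> < 1 / real (Suc k)" for k
  proof -
    have pos: "0 < t" if "t \<in> {1 / real (Suc k)..real (Suc k)}" for t
      using that by (simp add: less_le_trans[of 0 "1 / real (Suc k)"])
    have "continuous_on {1 / real (Suc k)..real (Suc k)} (\<lambda>t. 1 / sqrt t)"
      using pos by (intro continuous_intros) force
    then obtain g where g: "real_polynomial_function g"
      "\<And>t. t \<in> {1 / real (Suc k)..real (Suc k)} \<Longrightarrow> \<bar>1 / sqrt t - g t\<bar> < 1 / real (Suc k)"
      by (rule Stone_Weierstrass_real_polynomial_function[rotated, of _ _ "1 / real (Suc k)"]) auto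
    then show ?thesis
      using real_polynomial_function_imp_sum[OF g(1)] by blast
  qed
  then obtain a d where approx: "\<And>k t. t \<in> {1 / real (Suc k)..real (Suc k)} \<Longrightarrow>
      \<bar>1 / sqrt t - (\<Sum>i\<le>d k. a k i * t ^ i)\<bar> < 1 / real (Suc k)"
    by metis
  have "(\<lambda>k. \<Sum>i\<le>d k. a k i * t ^ i) \<longlonglongrightarrow> 1 / sqrt t" if t: "0 < t" for t
  proof (rule LIM_zero_cancel, rule Lim_null_comparison)
    have "\<forall>\<^sub>F k in sequentially. 1 / real (Suc k) < t"
      using LIMSEQ_inverse_real_of_nat t by (auto simp: inverse_eq_divide dest: order_tendstoD(2))
    moreover have "\<forall>\<^sub>F k in sequentially. t \<le> real (Suc k)"
      using eventually_ge_at_top[of "nat \<lceil>t\<rceil>"] by eventually_elim linarith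
    ultimately show "\<forall>\<^sub>F k in sequentially.
        norm ((\<Sum>i\<le>d k. a k i * t ^ i) - 1 / sqrt t) \<le> inverse (real (Suc k))"
    proof eventually_elim
      case (elim k)
      then show ?case
        using approx[of t k] by (simp add: inverse_eq_divide abs_minus_commute)
    qed
  qed (rule LIMSEQ_inverse_real_of_nat)
  then show ?thesis by (rule that)
qed

theorem proposition3:
  shows "(sparse_duality_map :: real ^ 'n ^ 'm \<Rightarrow> real ^ 'n ^ 'm) \<in> borel_measurable borel"
proof -
  obtain a d where approx: "\<And>t. 0 < t \<Longrightarrow> (\<lambda>k. \<Sum>i\<le>d k. a k i * t ^ i) \<longlonglongrightarrow> 1 / sqrt t"
    using exists_poly_approx_inverse_sqrt by metis
  define P :: "nat \<Rightarrow> real ^ 'n ^ 'm \<Rightarrow> real ^ 'n ^ 'm"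
    where "P k A = A ** matrix_poly (a k) (d k) (transpose A ** A)" for k A
  define F where "F k A = trace (transpose A ** P k A) *\<^sub>R P k A" for k A
  have "continuous_on UNIV (F k)" for k
    unfolding F_def P_def
    by (intro continuous_intros continuous_on_trace continuous_on_matrix_mult
        continuous_on_transpose continuous_on_matrix_poly)
  then have "F k \<in> borel_measurable borel" for k
    by (rule borel_measurable_continuous_onI)
  moreover have "(\<lambda>k. F k A) \<longlonglongrightarrow> sparse_duality_map A" for A
  proof -
    \<comment> \<open>The basis depends on \<open>A\<close>, with no regularity claimed for that
      dependence; it serves only to identify the pointwise limit and does not enter
      \<open>F\<close>.\<close>
    obtain V where RS: "right_singular_basis A V"
      using exists_right_singular_basis by blast
    note V = right_singular_basisD[OF RS]
    have lim: "(\<lambda>k. P k A *v v) \<longlonglongrightarrow> polar_factor A V *v v" if v: "v \<in> V" for v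
    proof -
      have P: "P k A *v v = (\<Sum>i\<le>d k. a k i * ((norm (A *v v))\<^sup>2) ^ i) *\<^sub>R (A *v v)" for k
        by (simp add: P_def matrix_vector_mul_assoc[symmetric] matrix_poly_eigenvector[OF V(2)[OF v]]
            matrix_vector_mult_scaleR)
      \<comment> \<open>At a positive eigenvalue the scalar tends to the reciprocal of the norm,
        turning \<open>A *v v\<close> into its \<open>sgn\<close>. On the kernel the leading factor
        \<open>A\<close> gives zero, whatever the polynomials do at 0.\<close>
      show ?thesis
      proof (cases "A *v v = 0")
        case False
        then have "(\<lambda>k. \<Sum>i\<le>d k. a k i * ((norm (A *v v))\<^sup>2) ^ i) \<longlonglongrightarrow> 1 / norm (A *v v)"
          using approx[of "(norm (A *v v))\<^sup>2"] by simp
        from tendsto_scaleR[OF this tendsto_const[of "A *v v"]] show ?thesis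
          unfolding P by (simp add: polar_factor_basis[OF V(1) v] sgn_div_norm inverse_eq_divide)
      qed (simp add: P polar_factor_basis[OF V(1) v])
    qed
    then have "(\<lambda>k. P k A) \<longlonglongrightarrow> polar_factor A V"
      by (rule tendsto_matrixI[OF V(1)])
    moreover have "(\<lambda>k. trace (transpose A ** P k A)) \<longlonglongrightarrow> trace (transpose A ** polar_factor A V)"
      unfolding trace_transpose_mult_orthonormal_basis[OF V(1)]
      by (intro tendsto_intros lim)
    ultimately show ?thesis
      unfolding F_def sparse_duality_map_eq[OF RS] trace_polar_factor[OF RS]
      by (intro tendsto_scaleR)
  qed
  ultimately show ?thesis
    by (rule borel_measurable_LIMSEQ_metric)
qed

end
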